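(* Let $V$ be a Banach module over the Clifford algebra $\mathbb{R}_n$, let $T:\operatorname{dom}(T)\subseteq V\to V$ be a closed right-linear operator and let $B\subseteq\operatorname{dom}(T)$ be a right submodule. Let $s=x+Jy\in\rho_{S,B}(T)$ with $x,y\in\mathbb{R}$, $J\in\mathbb{S}$, and let $v\in V$. Consider the two equations (the Cauchy-Riemann equations for the $S$-resolvent operators at $v$) $$-TQ_{s,B}[T]^{-1}TQ_{s,B}[T]^{-1}v+xTQ_{s,B}[T]^{-2}v+xQ_{s,B}[T]^{-1}TQ_{s,B}[T]^{-1}v+Q_{s,B}[T]^{-1}v-|s|^2Q_{s,B}[T]^{-2}v=0,\qquad (1)$$ $$y\bigl(TQ_{s,B}[T]^{-2}v-Q_{s,B}[T]^{-1}TQ_{s,B}[T]^{-1}v\bigr)=0.\qquad (2)$$ Then: (i) if $s\notin\mathbb{R}$, equations (1) and (2) both hold if and only if $Q_{s,B}[T]^{-1}v\in\ker\,[T,Q_{s,B}[T]^{-1}]$; (ii) if $s\in\mathbb{R}$, equations (1) and (2) both hold if and only if $[T,Q_{s,B}[T]^{-1}]\,Q_{s,B}[T]^{-1}v\in\ker(T-sI)$.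
   Context: $\mathbb{R}_n$ is the real Clifford algebra generated by imaginary units $e_1,\dots,e_n$ with $e_i^2=-1$, $e_ie_j=-e_je_i$ for $i\ne j$; its basis is $e_A=e_{i_1}\cdots e_{i_r}$, $A=(i_1<\dots<i_r)$. Paravectors: $\mathbb{R}^{n+1}=\{s=s_0+s_1e_1+\dots+s_ne_n : s_i\in\mathbb{R}\}\subset\mathbb{R}_n$, with $|s|^2=s_0^2+\dots+s_n^2$. $\mathbb{S}=\{J\in\mathbb{R}^{n+1}: J_0=0,\ |J|=1\}$; every paravector can be written $s=x+Jy$ with $x=s_0$, $y\in\mathbb{R}$, $J\in\mathbb{S}$, and then $|s|^2=x^2+y^2$. A Banach module over $\mathbb{R}_n$ is $V=\{\sum_A v_A\otimes e_A: v_A\in V_{\mathbb{R}}\}$ for a real Banach space $V_{\mathbb{R}}$, with norm $\|v\|^2=\sum_A\|v_A\|_{\mathbb{R}}^2$; it is a two-sided $\mathbb{R}_n$-module via multiplication of the $e_A$. Operators $T:\operatorname{dom}(T)\subseteq V\to V$ are right-linear with $\operatorname{dom}(T)$ a right submodule; closed means closed graph. $\mathcal{B}(V)$ is the set of bounded right-linear operators $V\to V$ (everywhere defined). For $s\in\mathbb{R}^{n+1}$ let $Q_s[T]=T^2-2s_0T+|s|^2I$ on $\operatorname{dom}(T^2)=\{u\in\operatorname{dom}(T):Tu\in\operatorname{dom}(T)\}$. For a right submodule $B\subseteq\operatorname{dom}(T)$ let $\operatorname{dom}_B(T^2)=\operatorname{dom}(T^2)\cap B$ and let $Q_{s,B}[T]$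 be the restriction of $Q_s[T]$ to $\operatorname{dom}_B(T^2)$. The $S$-resolvent set with boundary conditions $B$ is $\rho_{S,B}(T)=\{s\in\mathbb{R}^{n+1}: Q_{s,B}[T]^{-1}\in\mathcal{B}(V)\}$, i.e. $Q_{s,B}[T]:\operatorname{dom}_B(T^2)\to V$ is bijective with bounded inverse. $Q_{s,B}[T]^{-2}:=Q_{s,B}[T]^{-1}Q_{s,B}[T]^{-1}$. The commutator is $[T,Q_{s,B}[T]^{-1}]:=TQ_{s,B}[T]^{-1}-Q_{s,B}[T]^{-1}T$ with domain $\operatorname{dom}(T)$. *)

theory Defs
  imports "HOL-Analysis.Analysis"
begin

section \<open>Clifford algebra and Clifford modules\<close>

text \<open>
  The imaginary units are indexed by a finite linearly ordered type \<open>'n\<close>, so \<open>n = CARD('n)\<close>. The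
  basis elements \<open>e\<^sub>A\<close> are indexed by the subsets \<open>A\<close> of \<open>'n\<close>, and an element
  \<open>\<Sum>\<^sub>A v\<^sub>A \<otimes> e\<^sub>A\<close> of the Banach module over \<open>'v\<close> is the vector of its
  coefficients \<open>v\<^sub>A\<close>. The library norm on vectors is \<open>(\<Sum>\<^sub>A \<parallel>v\<^sub>A\<parallel>\<^sup>2)\<^sup>1\<^sup>/\<^sup>2\<close>, as required.
  The library product \<open>*\<close> on vectors is componentwise and is not the Clifford product, which is
  \<open>cliff_rmult\<close> (equivalently \<open>cliff_lmult\<close>) for \<open>'v = real\<close>.
\<close>

type_synonym ('v, 'n) clifford_module = "('v, 'n set) vec"
type_synonym 'n clifford = "(real, 'n set) vec"

text \<open>
  \<open>e\<^sub>A e\<^sub>B = clifford_sign A B \<cdot> e\<^sub>C\<close> with \<open>C\<close> the symmetric difference of \<open>A\<close> and \<open>B\<close>: sorting the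
  product costs one sign for every pair \<open>i > j\<close> with \<open>i \<in> A\<close>, \<open>j \<in> B\<close>, and the squares
  \<open>e\<^sub>i e\<^sub>i = -1\<close> cost one sign for every \<open>i \<in> A \<inter> B\<close>.
\<close>

definition clifford_sign :: "'n::{finite,linorder} set \<Rightarrow> 'n set \<Rightarrow> real" where
  "clifford_sign A B = (- 1) ^ card {(i, j). i \<in> A \<and> j \<in> B \<and> j \<le> i}"

definition cliff_rmult ::
  "('v::real_vector, 'n::{finite,linorder}) clifford_module \<Rightarrow> 'n clifford \<Rightarrow> ('v, 'n) clifford_module" where
  "cliff_rmult v a =
    (\<Sum>A\<in>UNIV. \<Sum>B\<in>UNIV. axis (sym_diff A B) ((clifford_sign A B * a $ B) *\<^sub>R (v $ A)))"

definition cliff_lmult ::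
  "'n::{finite,linorder} clifford \<Rightarrow> ('v::real_vector, 'n) clifford_module \<Rightarrow> ('v, 'n) clifford_module" where
  "cliff_lmult a v =
    (\<Sum>A\<in>UNIV. \<Sum>B\<in>UNIV. axis (sym_diff A B) ((clifford_sign A B * a $ A) *\<^sub>R (v $ B)))"

definition cliff_of_real :: "real \<Rightarrow> 'n::{finite,linorder} clifford" where
  "cliff_of_real x = axis {} x"

definition cliff_reals :: "'n::{finite,linorder} clifford set" where
  "cliff_reals = range cliff_of_real"

definition paravectors :: "'n::{finite,linorder} clifford set" where
  "paravectors = {s. \<forall>A. card A \<ge> 2 \<longrightarrow> s $ A = 0}"

definition scalar_part :: "'n::{finite,linorder} clifford \<Rightarrow> real" where
  "scalar_part s = s $ {}"

definition imaginary_sphere :: "'n::{finite,linorder} clifford set" where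
  "imaginary_sphere = {J \<in> paravectors. scalar_part J = 0 \<and> norm J = 1}"

definition right_submodule :: "('v::real_vector, 'n::{finite,linorder}) clifford_module set \<Rightarrow> bool" where
  "right_submodule B \<longleftrightarrow>
    0 \<in> B \<and> (\<forall>u\<in>B. \<forall>w\<in>B. u + w \<in> B) \<and> (\<forall>u\<in>B. \<forall>a. cliff_rmult u a \<in> B)"


subsection \<open>The defining relations and the module laws\<close>

lemma clifford_sign_prod:
  "clifford_sign A B = (\<Prod>i\<in>A. \<Prod>j\<in>B. if j \<le> i then - 1 else 1)"
proof -
  have "{(i, j). i \<in> A \<and> j \<in> B \<and> j \<le> i} = {p \<in> A \<times> B. snd p \<le> fst p}" by auto
  moreover have "(\<Prod>p\<in>A \<times> B. if snd p \<le> fst p then - 1 else (1::real)) =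
      (- 1) ^ card {p \<in> A \<times> B. snd p \<le> fst p}"
    by (subst prod.inter_filter[symmetric]) auto
  ultimately show ?thesis
    by (simp add: clifford_sign_def prod.cartesian_product case_prod_unfold)
qed

lemma clifford_sign_square: "clifford_sign A B * clifford_sign A B = 1"
  by (simp add: clifford_sign_def flip: power_add mult_2)

lemma prod_sym_diff:
  fixes f :: "'n::finite \<Rightarrow> real"
  assumes "\<And>i. f i * f i = 1"
  shows "prod f (sym_diff A B) = prod f A * prod f B"
proof -
  have A: "prod f A = prod f (A - B) * prod f (A \<inter> B)"
    by (subst prod.union_disjoint[symmetric]) (auto intro: arg_cong[where f = "prod f"])
  have B: "prod f B = prod f (B - A) * prod f (A \<inter> B)"
    by (subst prod.union_disjoint[symmetric]) (auto intro: arg_cong[where f = "prod f"])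
  have "prod f (A \<inter> B) * prod f (A \<inter> B) = 1"
    by (simp add: assms flip: prod.distrib)
  moreover have "prod f (sym_diff A B) = prod f (A - B) * prod f (B - A)"
    by (rule prod.union_disjoint) auto
  ultimately show ?thesis by (simp add: A B algebra_simps)
qed

lemma clifford_sign_sym_diff_left:
  "clifford_sign (sym_diff A B) C = clifford_sign A C * clifford_sign B C"
  unfolding clifford_sign_prod
  by (rule prod_sym_diff) (simp flip: prod.distrib add: if_distrib cong: if_cong)

lemma clifford_sign_sym_diff_right:
  "clifford_sign A (sym_diff B C) = clifford_sign A B * clifford_sign A C"
  unfolding clifford_sign_prod
  by (subst (1 2 3) prod.swap, rule prod_sym_diff)
     (simp flip: prod.distrib add: if_distrib cong: if_cong)

lemma clifford_sign_cocycle: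
  "clifford_sign A B * clifford_sign (sym_diff A B) C =
   clifford_sign B C * clifford_sign A (sym_diff B C)"
  by (simp add: clifford_sign_sym_diff_left clifford_sign_sym_diff_right)

lemma cliff_rmult_add_left: "cliff_rmult (u + v) a = cliff_rmult u a + cliff_rmult v a"
  and cliff_rmult_add_right: "cliff_rmult u (a + b) = cliff_rmult u a + cliff_rmult u b"
  and cliff_lmult_add_left: "cliff_lmult (a + b) u = cliff_lmult a u + cliff_lmult b u"
  and cliff_lmult_add_right: "cliff_lmult a (u + v) = cliff_lmult a u + cliff_lmult a v"
  by (simp_all add: cliff_rmult_def cliff_lmult_def algebra_simps axis_def vec_eq_iff
      sum.distrib[symmetric] if_distrib cong: if_cong)

lemma cliff_rmult_axis:
  fixes v :: "'v::real_vector"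
  shows "cliff_rmult (axis A v) (axis B c) = axis (sym_diff A B) ((clifford_sign A B * c) *\<^sub>R v)"
proof -
  have "(\<Sum>B'\<in>UNIV. axis (sym_diff A' B') ((clifford_sign A' B' * axis B c $ B') *\<^sub>R (axis A v $ A')))
      = (if A' = A then axis (sym_diff A B) ((clifford_sign A B * c) *\<^sub>R v) else 0)" for A'
    by (subst sum.remove[where x = B]) (auto simp: axis_def vec_eq_iff intro!: sum.neutral)
  then show ?thesis by (simp add: cliff_rmult_def)
qed

lemma cliff_lmult_axis:
  fixes v :: "'v::real_vector"
  shows "cliff_lmult (axis A c) (axis B v) = axis (sym_diff A B) ((clifford_sign A B * c) *\<^sub>R v)"
proof -
  have "(\<Sum>B'\<in>UNIV. axis (sym_diff A' B') ((clifford_sign A' B' * axis A c $ A') *\<^sub>R (axis B v $ B')))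
      = (if A' = A then axis (sym_diff A B) ((clifford_sign A B * c) *\<^sub>R v) else 0)" for A'
    by (subst sum.remove[where x = B]) (auto simp: axis_def vec_eq_iff intro!: sum.neutral)
  then show ?thesis by (simp add: cliff_lmult_def)
qed

lemma axis_induct [case_names axis add]:
  fixes v :: "('v::real_vector, 'i::finite) vec"
  assumes axis: "\<And>A c. P (axis A c)" and add: "\<And>u w. P u \<Longrightarrow> P w \<Longrightarrow> P (u + w)"
  shows "P v"
proof -
  have "P 0" using axis[of undefined 0] by (simp add: axis_def zero_vec_def)
  have "P (\<Sum>A\<in>S. axis A (v $ A))" if "finite S" for S
    using that by (induction S) (auto simp: \<open>P 0\<close> intro: axis add)
  moreover have "(\<Sum>A\<in>UNIV. axis A (v $ A)) = v"
    by (simp add: vec_eq_iff axis_def)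
  ultimately show ?thesis by (metis finite)
qed

lemma sym_diff_assoc: "sym_diff (sym_diff A B) C = sym_diff A (sym_diff B C)"
  by blast

lemma cliff_rmult_assoc: "cliff_rmult (cliff_rmult v a) b = cliff_rmult v (cliff_rmult a b)"
proof (induction v rule: axis_induct)
  case v: (axis A c)
  show ?case
  proof (induction a rule: axis_induct)
    case a: (axis B d)
    show ?case
    proof (induction b rule: axis_induct)
      case (axis C e)
      show ?case
        using clifford_sign_cocycle[of A B C]
        by (simp add: cliff_rmult_axis sym_diff_assoc mult_ac)
    qed (simp add: cliff_rmult_add_right)
  qed (simp add: cliff_rmult_add_right cliff_rmult_add_left)
qed (simp add: cliff_rmult_add_left)

lemma cliff_lmult_rmult: "cliff_rmult (cliff_lmult a v) b = cliff_lmult a (cliff_rmult v b)"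
proof (induction v rule: axis_induct)
  case v: (axis B c)
  show ?case
  proof (induction a rule: axis_induct)
    case a: (axis A d)
    show ?case
    proof (induction b rule: axis_induct)
      case (axis C e)
      show ?case
        using clifford_sign_cocycle[of A B C]
        by (simp add: cliff_rmult_axis cliff_lmult_axis sym_diff_assoc mult_ac)
    qed (simp add: cliff_rmult_add_right cliff_lmult_add_right)
  qed (simp add: cliff_lmult_add_left cliff_rmult_add_left)
qed (simp add: cliff_rmult_add_left cliff_lmult_add_right)

lemma cliff_lmult_assoc: "cliff_lmult a (cliff_lmult b v) = cliff_lmult (cliff_rmult a b) v"
proof (induction v rule: axis_induct)
  case v: (axis C c)
  show ?case
  proof (induction a rule: axis_induct)
    case a: (axis A d)
    show ?case
    proof (induction b rule: axis_induct)
      case (axis B e)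
      show ?case
        using clifford_sign_cocycle[of A B C]
        by (simp add: cliff_rmult_axis cliff_lmult_axis sym_diff_assoc mult_ac)
    qed (simp add: cliff_rmult_add_right cliff_lmult_add_right cliff_lmult_add_left)
  qed (simp add: cliff_lmult_add_left cliff_rmult_add_left)
qed (simp add: cliff_lmult_add_right)

lemma cliff_lmult_eq_rmult: "cliff_lmult a b = cliff_rmult a b" for b :: "'n::{finite,linorder} clifford"
proof (induction a rule: axis_induct)
  case a: (axis A c)
  show ?case
    by (induction b rule: axis_induct)
      (simp_all add: cliff_lmult_axis cliff_rmult_axis cliff_lmult_add_right cliff_rmult_add_right mult_ac)
qed (simp add: cliff_lmult_add_left cliff_rmult_add_left)

lemma cliff_rmult_of_real: "cliff_rmult v (cliff_of_real x) = x *\<^sub>R v"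
  by (induction v rule: axis_induct)
    (simp_all add: cliff_of_real_def cliff_rmult_axis cliff_rmult_add_left scaleR_add_right
      clifford_sign_def, simp add: vec_eq_iff axis_def)

lemma cliff_lmult_of_real: "cliff_lmult (cliff_of_real x) v = x *\<^sub>R v"
  by (induction v rule: axis_induct)
    (simp_all add: cliff_of_real_def cliff_lmult_axis cliff_lmult_add_right scaleR_add_right
      clifford_sign_def, simp add: vec_eq_iff axis_def)

lemma clifford_unit_square:
  "cliff_rmult (axis {i} 1) (axis {i} 1) = cliff_of_real (- 1)"
proof -
  have "{(k, j). k \<in> {i} \<and> j \<in> {i} \<and> j \<le> k} = {(i, i)}" by auto
  then have "clifford_sign {i} {i} = - 1" by (simp only: clifford_sign_def) simp
  then show ?thesis by (simp add: cliff_rmult_axis cliff_of_real_def)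
qed

lemma clifford_units_anticommute:
  assumes "i \<noteq> j"
  shows "cliff_rmult (axis {i} 1) (axis {j} 1) = - cliff_rmult (axis {j} 1) (axis {i} (1::real))"
proof -
  have "sym_diff {j} {i} = sym_diff {i} {j}" by blast
  moreover have "clifford_sign {i} {j} = - clifford_sign {j} {i}"
    using assms by (auto simp: clifford_sign_prod)
  ultimately show ?thesis
    by (simp only: cliff_rmult_axis) (simp add: vec_eq_iff axis_def)
qed

text \<open>\<open>e\<^sub>A\<close> is the ordered product of its units.\<close>

lemma clifford_basis_insert:
  assumes "\<And>i. i \<in> A \<Longrightarrow> i < j"
  shows "cliff_rmult (axis A 1) (axis {j} 1) = axis (insert j A) (1::real)"
proof -
  have "clifford_sign A {j} = 1"
    using assms by (auto simp: clifford_sign_prod not_le intro!: prod.neutral)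
  moreover have "sym_diff A {j} = insert j A" using assms by auto
  ultimately show ?thesis by (simp add: cliff_rmult_axis)
qed


section \<open>Operators with domains\<close>

text \<open>
  An operator in \<open>V\<close> is a partial function \<open>V \<rightharpoonup> V\<close>, with \<open>dom\<close> its domain, \<open>|`\<close> the restriction and
  \<open>A \<circ>\<^sub>m B\<close> the composition, which is defined at \<open>u\<close> iff \<open>u \<in> dom B\<close> and \<open>B u \<in> dom A\<close>.
  Sums and differences are defined on the intersection of the domains. An equation \<open>A u = Some w\<close>
  asserts that \<open>u\<close> lies in the domain of \<open>A\<close> and that the value there is \<open>w\<close>.
\<close>

abbreviation op_comp :: "('a \<rightharpoonup> 'a) \<Rightarrow> ('a \<rightharpoonup> 'a) \<Rightarrow> ('a \<rightharpoonup> 'a)"  (infixl "\<cdot>\<^sub>o" 80) where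
  "A \<cdot>\<^sub>o B \<equiv> A \<circ>\<^sub>m B"

definition op_add :: "('a \<rightharpoonup> 'a::plus) \<Rightarrow> ('a \<rightharpoonup> 'a) \<Rightarrow> ('a \<rightharpoonup> 'a)"  (infixl "+\<^sub>o" 65) where
  "(A +\<^sub>o B) u = (case (A u, B u) of (Some a, Some b) \<Rightarrow> Some (a + b) | _ \<Rightarrow> None)"

definition op_diff :: "('a \<rightharpoonup> 'a::minus) \<Rightarrow> ('a \<rightharpoonup> 'a) \<Rightarrow> ('a \<rightharpoonup> 'a)"  (infixl "-\<^sub>o" 65) where
  "(A -\<^sub>o B) u = (case (A u, B u) of (Some a, Some b) \<Rightarrow> Some (a - b) | _ \<Rightarrow> None)"

definition op_uminus :: "('a \<rightharpoonup> 'a::uminus) \<Rightarrow> ('a \<rightharpoonup> 'a)" where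
  "op_uminus A u = map_option uminus (A u)"

definition op_scale :: "real \<Rightarrow> ('a \<rightharpoonup> 'a::real_vector) \<Rightarrow> ('a \<rightharpoonup> 'a)"  (infixr "*\<^sub>o" 75) where
  "(c *\<^sub>o A) u = map_option (scaleR c) (A u)"

definition op_id :: "'a \<rightharpoonup> 'a" where
  "op_id u = Some u"

text \<open>The operator \<open>s I\<close>, i.e. left multiplication by \<open>s\<close>.\<close>

definition op_clifford :: "'n::{finite,linorder} clifford \<Rightarrow>
    (('v::real_vector, 'n) clifford_module \<rightharpoonup> ('v, 'n) clifford_module)" where
  "op_clifford s u = Some (cliff_lmult s u)"

definition op_ker :: "('a \<rightharpoonup> 'a::zero) \<Rightarrow> 'a set" where
  "op_ker A = {u. A u = Some 0}"

definition op_bij :: "('a \<rightharpoonup> 'a) \<Rightarrow> bool" where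
  "op_bij A \<longleftrightarrow> inj_on A (dom A) \<and> ran A = UNIV"

text \<open>Only meaningful for operators that are injective on their domain.\<close>

definition op_inv :: "('a \<rightharpoonup> 'a) \<Rightarrow> ('a \<rightharpoonup> 'a)" where
  "op_inv A w = (if w \<in> ran A then Some (THE u. A u = Some w) else None)"

text \<open>The domain of the commutator is the natural one; it is \<open>dom T\<close> when \<open>R\<close> is everywhere defined
  with values in \<open>dom T\<close>.\<close>

definition op_commutator :: "('a \<rightharpoonup> 'a::minus) \<Rightarrow> ('a \<rightharpoonup> 'a) \<Rightarrow> ('a \<rightharpoonup> 'a)" where
  "op_commutator T R = T \<cdot>\<^sub>o R -\<^sub>o R \<cdot>\<^sub>o T"

definition closed_op :: "('a::topological_space \<rightharpoonup> 'a) \<Rightarrow> bool" where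
  "closed_op A \<longleftrightarrow> closed {(u, w). A u = Some w}"

definition right_linear ::
  "(('v::real_vector, 'n::{finite,linorder}) clifford_module \<rightharpoonup> ('v, 'n) clifford_module) \<Rightarrow> bool" where
  "right_linear A \<longleftrightarrow> right_submodule (dom A) \<and>
    (\<forall>u u' w w'. A u = Some w \<longrightarrow> A u' = Some w' \<longrightarrow> A (u + u') = Some (w + w')) \<and>
    (\<forall>u w a. A u = Some w \<longrightarrow> A (cliff_rmult u a) = Some (cliff_rmult w a))"

definition bounded_right_linear_ops ::
  "(('v::real_normed_vector, 'n::{finite,linorder}) clifford_module \<rightharpoonup> ('v, 'n) clifford_module) set" where
  "bounded_right_linear_ops =
    {A. right_linear A \<and> dom A = UNIV \<and> (\<exists>K. \<forall>u. norm (the (A u)) \<le> K * norm u)}"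


section \<open>The S-resolvent set with boundary conditions\<close>

definition Q_op :: "'n::{finite,linorder} clifford \<Rightarrow>
    (('v::real_normed_vector, 'n) clifford_module \<rightharpoonup> ('v, 'n) clifford_module) \<Rightarrow>
    (('v, 'n) clifford_module \<rightharpoonup> ('v, 'n) clifford_module)" where
  "Q_op s T = T \<cdot>\<^sub>o T -\<^sub>o (2 * scalar_part s) *\<^sub>o T +\<^sub>o (norm s)\<^sup>2 *\<^sub>o op_id"

definition QB_op :: "'n::{finite,linorder} clifford \<Rightarrow>
    ('v::real_normed_vector, 'n) clifford_module set \<Rightarrow>
    (('v, 'n) clifford_module \<rightharpoonup> ('v, 'n) clifford_module) \<Rightarrow>
    (('v, 'n) clifford_module \<rightharpoonup> ('v, 'n) clifford_module)" where
  "QB_op s B T = Q_op s T |` B"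

definition S_resolvent_set :: "('v::real_normed_vector, 'n::{finite,linorder}) clifford_module set \<Rightarrow>
    (('v, 'n) clifford_module \<rightharpoonup> ('v, 'n) clifford_module) \<Rightarrow> 'n clifford set" where
  "S_resolvent_set B T =
    {s \<in> paravectors. op_bij (QB_op s B T) \<and> op_inv (QB_op s B T) \<in> bounded_right_linear_ops}"

lemma dom_Q_op: "dom (Q_op s T) = {u \<in> dom T. the (T u) \<in> dom T}"
  by (auto simp: Q_op_def op_add_def op_diff_def op_scale_def op_id_def map_comp_def
      split: option.splits)

lemma dom_QB_op: "dom (QB_op s B T) = dom (T \<cdot>\<^sub>o T) \<inter> B"
  by (auto simp: QB_op_def dom_Q_op map_comp_def split: option.splits)

end

(* For w = R v, z = R w and c = [T, R] w, the identity w = Q z = T (T z) - 2 x T z + |s|^2 z turns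
   the left-hand side of the first equation into T c - x c, and that of the second is y c. *)

theory Submission
  imports Defs
begin

text \<open>Write \<open>c\<close> for the commutator applied to \<open>R v\<close>. Using that the
  quadratic operator inverts \<open>R\<close>, equation (1) collapses to
  \<open>T c - x c = 0\<close>, while (2) is \<open>y c = 0\<close>. For real \<open>s\<close>, (2)
  is vacuous and (1) says that \<open>c\<close> is in the kernel of \<open>T - s I\<close>;
  otherwise (2) forces \<open>c = 0\<close>, and then (1) is automatic. The other burden is domains:
  \<open>op_inv_bij\<close> and \<open>QB_op_eq_Some_iff\<close> name every intermediate vector, so
  all compositions involved are defined at \<open>v\<close>, and \<open>right_linear_diff\<close>
  puts \<open>c\<close> into the domain of \<open>T\<close>.\<close>

lemma QB_op_eq_Some_iff:
  "QB_op s B T u = Some w \<longleftrightarrow>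
    u \<in> B \<and> (\<exists>a b. T u = Some a \<and> T a = Some b \<and>
      w = b - (2 * scalar_part s) *\<^sub>R a + (norm s)\<^sup>2 *\<^sub>R u)"
  by (auto simp: QB_op_def restrict_map_def Q_op_def op_add_def op_diff_def op_scale_def op_id_def
      map_comp_def split: option.splits)

text \<open>Surjectivity makes the inverse defined at every \<open>w\<close>; injectivity makes the
  vector chosen by \<open>THE\<close> the preimage.\<close>

lemma op_inv_bij:
  assumes "op_bij A"
  obtains u where "op_inv A w = Some u" "A u = Some w"
proof -
  have ran: "w \<in> ran A" using assms by (simp add: op_bij_def)
  then obtain u where u: "A u = Some w" by (auto simp: ran_def)
  have "(THE u. A u = Some w) = u"
    using assms u by (intro the_equality) (auto simp: op_bij_def inj_on_def dom_def)
  then show thesis using that u ran by (simp add: op_inv_def)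
qed

text \<open>Right linearity mentions only sums and Clifford multiples; negation is right
  multiplication by the real number -1.\<close>

lemma right_linear_diff:
  assumes "right_linear T" and u: "T u = Some w" and u': "T u' = Some w'"
  shows "T (u - u') = Some (w - w')"
proof -
  have "T (cliff_rmult u' (cliff_of_real (- 1))) = Some (cliff_rmult w' (cliff_of_real (- 1)))"
    using assms by (auto simp: right_linear_def)
  then have "T (- u') = Some (- w')"
    by (simp add: cliff_rmult_of_real)
  with assms have "T (u + - u') = Some (w + - w')"
    unfolding right_linear_def by blast
  then show ?thesis by simp
qed

lemma scalar_part_slice:
  assumes "J \<in> imaginary_sphere"
  shows "scalar_part (cliff_of_real x + y *\<^sub>R J) = x"
  using assms by (simp add: imaginary_sphere_def scalar_part_def cliff_of_real_def axis_def)

text \<open>Comparing scalar parts leaves \<open>y J = 0\<close>, and \<open>J\<close> is nonzero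
  because its norm is 1.\<close>

lemma slice_in_cliff_reals_iff:
  fixes J :: "'n::{finite,linorder} clifford"
  assumes "J \<in> imaginary_sphere"
  shows "cliff_of_real x + y *\<^sub>R J \<in> cliff_reals \<longleftrightarrow> y = 0"
proof
  assume "cliff_of_real x + y *\<^sub>R J \<in> cliff_reals"
  then obtain r where r: "cliff_of_real x + y *\<^sub>R J = cliff_of_real r"
    by (auto simp: cliff_reals_def)
  have "scalar_part (cliff_of_real r :: 'n clifford) = r"
    by (simp add: scalar_part_def cliff_of_real_def axis_def)
  then have "r = x"
    using scalar_part_slice[OF assms, of x y] r by simp
  with r have "y *\<^sub>R J = 0" by simp
  moreover have "J \<noteq> 0" using assms by (auto simp: imaginary_sphere_def)
  ultimately show "y = 0" by simp
qed (simp add: cliff_reals_def)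

theorem theorem5p5:
  fixes T :: "('v::banach, 'n::{finite,linorder}) clifford_module \<rightharpoonup> ('v, 'n) clifford_module"
    and B :: "('v, 'n) clifford_module set"
    and s J :: "'n clifford"
    and x y :: real
    and v :: "('v, 'n) clifford_module"
    and R :: "('v, 'n) clifford_module \<rightharpoonup> ('v, 'n) clifford_module"
  assumes "right_linear T"
    and "closed_op T"
    and "right_submodule B"
    and "B \<subseteq> dom T"
    and "J \<in> imaginary_sphere"
    and "s = cliff_of_real x + y *\<^sub>R J"
    and "s \<in> S_resolvent_set B T"
  defines "R \<equiv> op_inv (QB_op s B T)"
  defines "CR1 \<equiv> (op_uminus (T \<cdot>\<^sub>o R \<cdot>\<^sub>o T \<cdot>\<^sub>o R) +\<^sub>o x *\<^sub>o (T \<cdot>\<^sub>o (R \<cdot>\<^sub>o R)) +\<^sub>o x *\<^sub>o (R \<cdot>\<^sub>o T \<cdot>\<^sub>o R)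
        +\<^sub>o R -\<^sub>o (norm s)\<^sup>2 *\<^sub>o (R \<cdot>\<^sub>o R)) v = Some 0"
    and "CR2 \<equiv> (y *\<^sub>o (T \<cdot>\<^sub>o (R \<cdot>\<^sub>o R) -\<^sub>o R \<cdot>\<^sub>o T \<cdot>\<^sub>o R)) v = Some 0"
  shows "(s \<notin> cliff_reals \<longrightarrow>
           (CR1 \<and> CR2 \<longleftrightarrow> (\<exists>w \<in> op_ker (op_commutator T R). R v = Some w))) \<and>
         (s \<in> cliff_reals \<longrightarrow>
           (CR1 \<and> CR2 \<longleftrightarrow>
             (\<exists>w \<in> op_ker (T -\<^sub>o op_clifford s). (op_commutator T R \<cdot>\<^sub>o R) v = Some w)))"
proof -
  have bij: "op_bij (QB_op s B T)"
    using assms(7) by (simp add: S_resolvent_set_def)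
  have x: "scalar_part s = x"
    using scalar_part_slice[OF assms(5)] assms(6) by simp
  have y: "s \<in> cliff_reals \<longleftrightarrow> y = 0"
    using slice_in_cliff_reals_iff[OF assms(5)] assms(6) by simp
  obtain w where w: "R v = Some w" "QB_op s B T w = Some v"
    unfolding R_def by (rule op_inv_bij[OF bij])
  then obtain a where a: "T w = Some a"
    by (auto simp: QB_op_eq_Some_iff)
  obtain z where z: "R w = Some z" "QB_op s B T z = Some w"
    unfolding R_def by (rule op_inv_bij[OF bij])
  then obtain b d where b: "T z = Some b" and d: "T b = Some d"
    and w_eq: "w = d - (2 * x) *\<^sub>R b + (norm s)\<^sup>2 *\<^sub>R z"
    by (auto simp: QB_op_eq_Some_iff x)
  obtain p where p: "R a = Some p" "QB_op s B T p = Some a"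
    unfolding R_def by (rule op_inv_bij[OF bij])
  then obtain q where q: "T p = Some q"
    by (auto simp: QB_op_eq_Some_iff)
  define c where "c = b - p"
  \<comment> \<open>Here \<open>b = T z\<close> is in the domain of \<open>T\<close> because
    \<open>z\<close>, a value of \<open>R\<close>, is in the domain of \<open>T\<close> squared;
    \<open>p\<close> is also a value of \<open>R\<close>.\<close>
  have c: "T c = Some (d - q)"
    unfolding c_def by (rule right_linear_diff[OF assms(1) d q])
  note op_simps = op_add_def op_diff_def op_scale_def op_uminus_def map_comp_def
  have "CR1 \<longleftrightarrow> - q + x *\<^sub>R b + x *\<^sub>R p + w - (norm s)\<^sup>2 *\<^sub>R z = 0"
    by (simp add: CR1_def op_simps w z a b p q)
  \<comment> \<open>Expanding the lone \<open>w\<close> as Q applied to \<open>z\<close> cancels the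
    \<open>z\<close> terms, brings in \<open>d\<close>, and turns \<open>x b\<close> into
    \<open>- x b\<close>.\<close>
  also have "- q + x *\<^sub>R b + x *\<^sub>R p + w - (norm s)\<^sup>2 *\<^sub>R z = (d - q) - x *\<^sub>R c"
    by (subst w_eq) (simp add: c_def algebra_simps flip: scaleR_2)
  finally have CR1: "CR1 \<longleftrightarrow> (d - q) - x *\<^sub>R c = 0" .
  have CR2: "CR2 \<longleftrightarrow> y *\<^sub>R c = 0"
    by (simp add: CR2_def op_simps w z a b p c_def)
  have comm: "op_commutator T R w = Some c"
    by (simp add: op_commutator_def op_simps z a b p c_def)
  show ?thesis
  proof (cases "y = 0")
    case True
    then have "op_clifford s c = Some (x *\<^sub>R c)"
      by (simp add: op_clifford_def assms(6) cliff_lmult_of_real)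
    then have "c \<in> op_ker (T -\<^sub>o op_clifford s) \<longleftrightarrow> (d - q) - x *\<^sub>R c = 0"
      by (simp add: op_ker_def op_diff_def c)
    moreover have "(op_commutator T R \<cdot>\<^sub>o R) v = Some c"
      by (simp add: map_comp_def w comm)
    ultimately show ?thesis
      using True y CR1 CR2 by auto
  next
    case False
    \<comment> \<open>Applying the difference rule to \<open>c - c\<close> gives
      \<open>T 0 = 0\<close>.\<close>
    have "d - q = 0" if "c = 0"
      using c right_linear_diff[OF assms(1) c c] that by simp
    then have "CR1 \<and> CR2 \<longleftrightarrow> c = 0"
      using False CR1 CR2 by auto
    moreover have "w \<in> op_ker (op_commutator T R) \<longleftrightarrow> c = 0"
      by (simp add: op_ker_def comm)
    ultimately show ?thesis
      using False y w(1) by auto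
  qed
qed

end
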